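(* Let $b_n\ge 0$ ($n\ge1$) be integers and, for $p\in[0,1]$, let $\widehat T^{p}_{b_1,b_2,\dots}=\inf\{n\ge1: |U_n^p|\ge b_n\}$. Then $\widehat T^{p}_{b_1,b_2,\dots}$ is stochastically increasing in $p \in [0,\frac12]$ and stochastically decreasing in $p \in [\frac12,1]$.
   Context: For $p\in[0,1]$, let $X_1^p,X_2^p,\dots$ be i.i.d. with $P(X_n^p=1)=p$ and $P(X_n^p=-1)=1-p$, and let $X_0\in\{+1,-1\}$ be independent of $X_1^p,X_2^p,\dots$ with $P(X_0=1)=P(X_0=-1)=\frac12$. Set $U_0^p=X_0$ and $U_n^p=X_0+X_1^p+\cdots+X_n^p$ for $n\ge1$. Convention: $\inf\emptyset=\infty$. A family of $\{1,2,\dots\}\cup\{\infty\}$-valued random variables $T^p$ is stochastically increasing (resp. decreasing) in $p$ on an interval if for every $n\ge1$ the probability $P(T^p>n)$ is non-decreasing (resp. non-increasing) in $p$ on that interval (the usual stochastic order). *)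

theory Defs
  imports "HOL-Probability.Probability"
begin

definition walk :: "('a \<Rightarrow> int) \<Rightarrow> (nat \<Rightarrow> 'a \<Rightarrow> int) \<Rightarrow> nat \<Rightarrow> 'a \<Rightarrow> int" where
  "walk X0 X n \<omega> = X0 \<omega> + (\<Sum>i=1..n. X i \<omega>)"

(* The infimum of the empty set in enat is \<infinity>. *)
definition exit_time :: "(nat \<Rightarrow> nat) \<Rightarrow> (nat \<Rightarrow> 'a \<Rightarrow> int) \<Rightarrow> 'a \<Rightarrow> enat" where
  "exit_time b U \<omega> = (INF n\<in>{n. 1 \<le> n \<and> int (b n) \<le> \<bar>U n \<omega>\<bar>}. enat n)"

definition stochastically_increasing_on ::
    "real set \<Rightarrow> 'a measure \<Rightarrow> (real \<Rightarrow> 'a \<Rightarrow> enat) \<Rightarrow> bool" where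
  "stochastically_increasing_on I M T \<longleftrightarrow>
     (\<forall>n\<ge>1. mono_on I (\<lambda>p. measure M {\<omega> \<in> space M. enat n < T p \<omega>}))"

definition stochastically_decreasing_on ::
    "real set \<Rightarrow> 'a measure \<Rightarrow> (real \<Rightarrow> 'a \<Rightarrow> enat) \<Rightarrow> bool" where
  "stochastically_decreasing_on I M T \<longleftrightarrow>
     (\<forall>n\<ge>1. antimono_on I (\<lambda>p. measure M {\<omega> \<in> space M. enat n < T p \<omega>}))"

end

theory Submission
  imports Defs
begin

text \<open>
  Write \<open>q = 1 - p\<close> and let \<open>V x\<close> be the probability that the \<open>p\<close>-biased walk, now at \<open>x\<close>, respects
  all barriers up to a fixed time. The random start makes the survival probability
  \<open>(V 1 + V (- 1)) / 2\<close>, a polynomial in \<open>p\<close>. Exchanging \<open>p\<close> with \<open>q\<close> mirrors the walk and leaves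
  this average fixed, so it suffices to show that its derivative is nonpositive for \<open>1/2 \<le> p \<le> 1\<close>.

  Raising \<open>p\<close> at a single step taken from \<open>\<plusminus>x\<close> changes survival by \<open>V (x + 1) - V (x - 1)\<close> at \<open>x\<close>
  and by \<open>V (1 - x) - V (- x - 1)\<close> at \<open>- x\<close>. The first change is nonpositive, but the second may be
  positive: at a negative position a stronger upward drift can help the walk. What saves the
  argument is that the negative position is the less likely one. A path from \<open>1\<close> to \<open>x\<close> and its
  mirror image from \<open>- 1\<close> to \<open>- x\<close> have probabilities in the ratio \<open>p ^ (x - 1) : q ^ (x - 1)\<close>. If
  the origin has been visited, the last excursion starts from \<open>0\<close> with a sign of its own, and
  reflecting only that excursion gives the ratio \<open>p ^ x : q ^ x\<close> instead. With either pair of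
  weights the combined effect of the two changes is nonpositive
  (\<open>power_weighted_surv_diff_le\<close>, \<open>power_Suc_weighted_surv_diff_le\<close>).

  These weights also fit the one-step recursion. If \<open>\<Phi> y = p ^ y * f y + q ^ y * g y\<close>, where
  \<open>f\<close> takes an up-step with weight \<open>p\<close> and \<open>g\<close> is a mirrored quantity moving with \<open>p\<close> and \<open>q\<close>
  exchanged, then one step turns \<open>\<Phi> y\<close> into \<open>\<Phi> (y + 1) + p * q * \<Phi> (y - 1)\<close> for \<open>y \<ge> 1\<close>, so a sign
  of \<open>\<Phi>\<close> is inherited. The weighted inequalities can therefore be proved by induction over the
  barriers, and the one for the derivative (\<open>shifted_power_weighted_dsurv_nonpos\<close>) gives the claim
  at \<open>y = 0\<close>.
\<close>

section \<open>The survival polynomial\<close>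

text \<open>
  The head of the list is the barrier for the current position, so that positions beyond it
  contribute \<open>0\<close> and the inductions need no separate treatment of an exit at the next step.
\<close>

fun surv :: "real \<Rightarrow> nat list \<Rightarrow> int \<Rightarrow> real" where
  "surv p [] x = 1"
| "surv p (b # bs) x =
     (if \<bar>x\<bar> < int b then p * surv p bs (x + 1) + (1 - p) * surv p bs (x - 1) else 0)"

text \<open>
  The recursion for \<open>surv\<close>, differentiated in \<open>p\<close> by the product rule; having the derivative as a
  recursive function lets its sign be studied by the same inductions.
\<close>

fun dsurv :: "real \<Rightarrow> nat list \<Rightarrow> int \<Rightarrow> real" where
  "dsurv p [] x = 0"
| "dsurv p (b # bs) x =
     (if \<bar>x\<bar> < int b then surv p bs (x + 1) - surv p bs (x - 1)
        + p * dsurv p bs (x + 1) + (1 - p) * dsurv p bs (x - 1) else 0)"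

lemma surv_has_real_derivative:
  "((\<lambda>p. surv p bs x) has_real_derivative dsurv p bs x) (at p)"
proof (induction bs arbitrary: x)
  case (Cons b bs)
  have "((\<lambda>p. p * surv p bs (x + 1) + (1 - p) * surv p bs (x - 1)) has_real_derivative
      (surv p bs (x + 1) - surv p bs (x - 1)
        + p * dsurv p bs (x + 1) + (1 - p) * dsurv p bs (x - 1))) (at p)"
    by (auto intro!: derivative_eq_intros Cons.IH simp: algebra_simps)
  then show ?case by simp
qed simp

lemma surv_reflect: "surv (1 - p) bs x = surv p bs (- x)"
proof (induction bs arbitrary: x)
  case (Cons b bs)
  have "- (x + 1) = - x - 1" "- (x - 1) = - x + 1" by simp_all
  then show ?case by (simp add: Cons.IH)
qed simp

lemma surv_nonneg: "0 \<le> p \<Longrightarrow> p \<le> 1 \<Longrightarrow> 0 \<le> surv p bs x"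
  by (induction bs arbitrary: x) auto

section \<open>Comparing survival from different positions\<close>

context
  fixes p :: real
  assumes half_le: "1/2 \<le> p" and le_one: "p \<le> 1"
begin

text \<open>
  With an upward drift it is better to stand lower on the positive side, and better at \<open>- y\<close> than
  at \<open>y\<close>, where the drift pushes towards the origin. The two facts need each other: the step down
  from \<open>0\<close> and \<open>2\<close> compares \<open>- 1\<close> with \<open>1\<close>, and a step from \<open>- y\<close> mirrors to one from \<open>y\<close> that moves
  with \<open>p\<close> and \<open>1 - p\<close> exchanged, which favours \<open>y - 1\<close> over \<open>y + 1\<close>.
\<close>

lemma surv_antimono_and_reflect_le:
  "surv p bs (int y + 2) \<le> surv p bs (int y) \<and> surv p bs (int y) \<le> surv p bs (- int y)"
proof (induction bs arbitrary: y)
  case (Cons b bs)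
  note nonneg = surv_nonneg[of p _ _]
  let ?V = "surv p bs"
  have K: "?V (int y + 2) \<le> ?V (int y)" and H: "?V (int y) \<le> ?V (- int y)" for y
    using Cons.IH by auto
  have step_out: "surv p (b # bs) (int y + 2) \<le> surv p (b # bs) (int y)"
  proof (cases "int y + 2 < int b")
    case True
    have up: "p * ?V (int y + 3) \<le> p * ?V (int y + 1)"
      using K[of "Suc y"] half_le by (intro mult_left_mono) (auto simp: algebra_simps)
    have "?V (int y + 1) \<le> ?V (int y - 1)"
    proof (cases y)
      case 0 then show ?thesis using H[of 1] by simp
    next
      case (Suc z) then show ?thesis using K[of z] by (simp add: algebra_simps)
    qed
    then have "(1 - p) * ?V (int y + 1) \<le> (1 - p) * ?V (int y - 1)"
      using le_one by (intro mult_left_mono) auto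
    with up True show ?thesis by (simp add: algebra_simps)
  next
    case False
    then have "surv p (b # bs) (int y + 2) = 0" by simp
    then show ?thesis using surv_nonneg[of p "b # bs" "int y"] half_le le_one by simp
  qed
  have step_refl: "surv p (b # bs) (int y) \<le> surv p (b # bs) (- int y)"
  proof (cases y)
    case (Suc z)
    have a1: "?V (int z + 2) \<le> ?V (- int z - 2)" using H[of "z + 2"] by (simp add: algebra_simps)
    have a2: "?V (int z) \<le> ?V (- int z)" using H[of z] .
    have a3: "?V (int z + 2) \<le> ?V (int z)" using K[of z] .
    \<comment> \<open>Exchanging the two weights shifts the mass \<open>2 * p - 1\<close> from \<open>z + 2\<close> to the better \<open>z\<close>.\<close>
    have "p * ?V (int z + 2) + (1 - p) * ?V (int z)
        = (1 - p) * ?V (int z + 2) + p * ?V (int z) - (2 * p - 1) * (?V (int z) - ?V (int z + 2))"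
      by (simp add: algebra_simps)
    also have "\<dots> \<le> (1 - p) * ?V (int z + 2) + p * ?V (int z)"
      using a3 half_le by simp
    also have "\<dots> \<le> (1 - p) * ?V (- int z - 2) + p * ?V (- int z)"
      using a1 a2 half_le le_one by (intro add_mono mult_left_mono) auto
    finally show ?thesis using Suc by (simp add: algebra_simps)
  qed simp
  show ?case using step_out step_refl by blast
qed simp

lemmas surv_antimono = surv_antimono_and_reflect_le[THEN conjunct1]
lemmas surv_le_reflect = surv_antimono_and_reflect_le[THEN conjunct2]

text \<open>
  Although survival is likelier from \<open>- y\<close> than from \<open>y\<close>, the weights more than make up for it:
  before they meet \<open>0\<close>, a path from \<open>y\<close> and its mirror image reach \<open>\<plusminus>z\<close> with total weights \<open>p ^ z\<close>
  and \<open>(1 - p) ^ z\<close> times a common factor, and at \<open>0\<close> they agree. This handles the barriers that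
  separate \<open>y\<close> from \<open>y + 2\<close> in the next lemma.
\<close>

lemma power_weighted_surv_reflect_le:
  "(1 - p) ^ y * surv p bs (- int y) \<le> p ^ y * surv p bs (int y)"
proof (induction bs arbitrary: y)
  case Nil
  show ?case using half_le le_one by (auto intro: power_mono)
next
  case (Cons b bs)
  show ?case
  proof (cases y)
    case (Suc z)
    let ?V = "surv p bs"
    let ?G = "\<lambda>y. p ^ y * ?V (int y) - (1 - p) ^ y * ?V (- int y)"
    have "0 \<le> ?G (z + 2)" "0 \<le> ?G z" using Cons.IH[of "z + 2"] Cons.IH[of z] by auto
    then have "0 \<le> ?G (z + 2) + p * (1 - p) * ?G z"
      using half_le le_one by (intro add_nonneg_nonneg mult_nonneg_nonneg) auto
    then show ?thesis using Suc by (simp add: algebra_simps)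
  qed simp
qed

text \<open>
  The combined effect of raising \<open>p\<close> for one step from \<open>\<plusminus>(y + 1)\<close>, with the weights of a walk that
  has not visited the origin: the possible gain on the negative side is at most the loss on the
  positive side. At \<open>y = 0\<close> the two terms at the origin cancel and only the comparison of \<open>2\<close> with
  \<open>- 2\<close> remains.
\<close>

lemma power_weighted_surv_diff_le:
  "(1 - p) ^ y * (surv p bs (- int y) - surv p bs (- int y - 2))
     \<le> p ^ y * (surv p bs (int y) - surv p bs (int y + 2))"
proof (induction bs arbitrary: y)
  case (Cons b bs)
  show ?case
  proof (cases y)
    case 0
    then show ?thesis using surv_le_reflect[of "b # bs" 2] by (simp del: surv.simps)
  next
    case (Suc z)
    show ?thesis
    proof (cases "int y + 2 < int b")
      case True
      let ?V = "surv p bs"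
      let ?F = "\<lambda>y. p ^ y * (?V (int y) - ?V (int y + 2))
        - (1 - p) ^ y * (?V (- int y) - ?V (- int y - 2))"
      have "0 \<le> ?F (z + 2)" "0 \<le> ?F z" using Cons.IH[of "z + 2"] Cons.IH[of z] by auto
      then have "0 \<le> ?F (z + 2) + p * (1 - p) * ?F z"
        using half_le le_one by (intro add_nonneg_nonneg mult_nonneg_nonneg) auto
      then show ?thesis using Suc True by (simp add: algebra_simps)
    next
      case False
      then have "surv p (b # bs) (int y + 2) = 0" "surv p (b # bs) (- int y - 2) = 0" by simp_all
      then show ?thesis using power_weighted_surv_reflect_le[of y "b # bs"]
        by (simp del: surv.simps)
    qed
  qed
qed simp

text \<open>
  The same effect with the weights of a walk that has visited the origin, which favour the positive
  side by a further factor \<open>p / (1 - p) \<ge> 1\<close>.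
\<close>

lemma power_Suc_weighted_surv_diff_le:
  "(1 - p) ^ Suc y * (surv p bs (- int y) - surv p bs (- int y - 2))
     \<le> p ^ Suc y * (surv p bs (int y) - surv p bs (int y + 2))"
proof -
  have "(1 - p) * ((1 - p) ^ y * (surv p bs (- int y) - surv p bs (- int y - 2)))
      \<le> (1 - p) * (p ^ y * (surv p bs (int y) - surv p bs (int y + 2)))"
    using power_weighted_surv_diff_le le_one by (intro mult_left_mono) auto
  also have "\<dots> \<le> p * (p ^ y * (surv p bs (int y) - surv p bs (int y + 2)))"
    using surv_antimono[of bs y] half_le by (intro mult_right_mono mult_nonneg_nonneg) auto
  finally show ?thesis by (simp add: algebra_simps)
qed

section \<open>The sign of the derivative\<close>

text \<open>
  The derivative recursion adds the effect of the current step to the effects of later steps, and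
  both are nonpositive. The weights here are those after a visit to the origin; the value at
  \<open>y = 0\<close> is what the next lemma needs when the walk reaches the origin for the first time.
\<close>

lemma power_weighted_dsurv_nonpos:
  "p ^ y * dsurv p bs (int y) + (1 - p) ^ y * dsurv p bs (- int y) \<le> 0"
proof (induction bs arbitrary: y)
  case (Cons b bs)
  let ?V = "surv p bs" and ?D = "dsurv p bs"
  let ?B = "\<lambda>y. p ^ y * ?D (int y) + (1 - p) ^ y * ?D (- int y)"
  show ?case
  proof (cases y)
    case 0
    have "?V 1 - ?V (- 1) \<le> 0" "?B 1 \<le> 0"
      using surv_le_reflect[of bs 1] Cons.IH[of 1] by auto
    then show ?thesis using 0 by simp
  next
    case (Suc z)
    have "p * (1 - p) * ?B z \<le> 0"
      using Cons.IH[of z] half_le le_one by (intro mult_nonneg_nonpos) auto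
    then have "(1 - p) ^ Suc z * (?V (- int z) - ?V (- int z - 2))
        - p ^ Suc z * (?V (int z) - ?V (int z + 2)) + ?B (z + 2) + p * (1 - p) * ?B z \<le> 0"
      using Cons.IH[of "z + 2"] power_Suc_weighted_surv_diff_le[of z bs] by linarith
    then show ?thesis using Suc by (simp add: algebra_simps)
  qed
qed simp

text \<open>
  The weights before a visit to the origin, at the positions \<open>\<plusminus>(y + 1)\<close>. From \<open>\<plusminus>1\<close> the walk may
  step to \<open>0\<close>, where these weights have no continuation and the previous lemma takes over. At
  \<open>y = 0\<close> the weights are equal, which is the symmetric start.
\<close>

lemma shifted_power_weighted_dsurv_nonpos:
  "p ^ y * dsurv p bs (int y + 1) + (1 - p) ^ y * dsurv p bs (- 1 - int y) \<le> 0"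
proof (induction bs arbitrary: y)
  case (Cons b bs)
  let ?V = "surv p bs" and ?D = "dsurv p bs"
  let ?A = "\<lambda>y. p ^ y * ?D (int y + 1) + (1 - p) ^ y * ?D (- 1 - int y)"
  note F = power_weighted_surv_diff_le[of y bs]
  show ?case
  proof (cases y)
    case 0
    have "?D 0 \<le> 0" using power_weighted_dsurv_nonpos[of 0 bs] by simp
    then have "?V 2 - ?V (- 2) + ?A 1 + ?D 0 \<le> 0"
      using Cons.IH[of 1] surv_le_reflect[of bs 2] by simp
    then show ?thesis using 0 by (simp add: algebra_simps)
  next
    case (Suc z)
    have "p * (1 - p) * ?A z \<le> 0"
      using Cons.IH[of z] half_le le_one by (intro mult_nonneg_nonpos) auto
    then have "(1 - p) ^ y * (?V (- int y) - ?V (- int y - 2))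
        - p ^ y * (?V (int y) - ?V (int y + 2)) + ?A (z + 2) + p * (1 - p) * ?A z \<le> 0"
      using Cons.IH[of "z + 2"] F by linarith
    then show ?thesis using Suc by (simp add: algebra_simps)
  qed
qed simp

end

lemma symmetric_surv_antimono:
  assumes "1/2 \<le> p" "p \<le> q" "q \<le> 1"
  shows "surv q bs 1 + surv q bs (- 1) \<le> surv p bs 1 + surv p bs (- 1)"
proof (rule DERIV_nonpos_imp_nonincreasing[where f = "\<lambda>p. surv p bs 1 + surv p bs (- 1)"])
  fix r assume "p \<le> r" "r \<le> q"
  then have "dsurv r bs 1 + dsurv r bs (- 1) \<le> 0"
    using shifted_power_weighted_dsurv_nonpos[of r 0 bs] assms by simp
  then show "\<exists>d. ((\<lambda>p. surv p bs 1 + surv p bs (- 1)) has_real_derivative d) (at r) \<and> d \<le> 0"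
    using DERIV_add[OF surv_has_real_derivative surv_has_real_derivative] by blast
qed (use assms in simp)

lemma symmetric_surv_mono:
  assumes "0 \<le> p" "p \<le> q" "q \<le> 1/2"
  shows "surv p bs 1 + surv p bs (- 1) \<le> surv q bs 1 + surv q bs (- 1)"
  using symmetric_surv_antimono[of "1 - q" "1 - p" bs] assms
  by (simp add: surv_reflect add.commute)

section \<open>From the random walk to the survival polynomial\<close>

lemma less_exit_time_iff:
  "enat n < exit_time b U \<omega> \<longleftrightarrow> (\<forall>m\<in>{1..n}. \<bar>U m \<omega>\<bar> < int (b m))"
proof
  assume less: "enat n < exit_time b U \<omega>"
  show "\<forall>m\<in>{1..n}. \<bar>U m \<omega>\<bar> < int (b m)"
  proof (rule ballI, rule ccontr)
    fix m assume m: "m \<in> {1..n}" "\<not> \<bar>U m \<omega>\<bar> < int (b m)"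
    then have "exit_time b U \<omega> \<le> enat m"
      unfolding exit_time_def by (intro INF_lower) auto
    with less have "enat n < enat m" by (rule less_le_trans)
    with m show False by simp
  qed
next
  assume inside: "\<forall>m\<in>{1..n}. \<bar>U m \<omega>\<bar> < int (b m)"
  have "enat (Suc n) \<le> exit_time b U \<omega>"
    unfolding exit_time_def
  proof (rule INF_greatest)
    fix m assume "m \<in> {n. 1 \<le> n \<and> int (b n) \<le> \<bar>U n \<omega>\<bar>}"
    with inside have "\<not> m \<le> n" by (auto simp: not_le[symmetric])
    then show "enat (Suc n) \<le> enat m" by simp
  qed
  then show "enat n < exit_time b U \<omega>"
    by (rule less_le_trans[rotated]) simp
qed

lemma measurable_partial_sum_int:
  fixes Y :: "nat \<Rightarrow> 'a \<Rightarrow> int"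
  assumes "\<And>i. Y i \<in> measurable M (count_space UNIV)"
  shows "(\<lambda>\<omega>. \<Sum>i\<le>m. Y i \<omega>) \<in> measurable M (count_space UNIV)"
proof (induction m)
  case 0
  then show ?case using assms by simp
next
  case (Suc m)
  have "(\<lambda>\<omega>. (\<lambda>z \<omega>. z + Y (Suc m) \<omega>) (\<Sum>i\<le>m. Y i \<omega>) \<omega>) \<in> measurable M (count_space UNIV)"
    by (rule measurable_compose_countable[OF measurable_compose[OF assms] Suc.IH]) simp
  then show ?case by simp
qed

lemma pred_abs_partial_sum_less:
  fixes Y :: "nat \<Rightarrow> 'a \<Rightarrow> int"
  assumes "\<And>i. Y i \<in> measurable M (count_space UNIV)"
  shows "Measurable.pred M (\<lambda>\<omega>. \<bar>\<Sum>i\<le>m. Y i \<omega>\<bar> < c)"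
  by (rule measurable_compose[OF measurable_partial_sum_int[OF assms]]) simp

lemma walk_eq_sum_atMost: "walk X0 X n \<omega> = (\<Sum>i\<le>n. (if i = 0 then X0 else X i) \<omega>)"
proof -
  have "{..n} = insert 0 {1..n}" by auto
  then show ?thesis unfolding walk_def by simp
qed

context prob_space
begin

text \<open>
  Fixing the whole initial segment of \<open>Y\<close>, rather than only its sum, turns the Markov property into
  an induction on the number of remaining barriers: appending one more value multiplies the
  probability of the segment by that of the new value, by independence.
\<close>

lemma prob_prefix_and_inside:
  fixes Y :: "nat \<Rightarrow> 'a \<Rightarrow> int" and p :: real
  assumes indep: "indep_vars (\<lambda>_. count_space UNIV) Y UNIV"
    and up: "\<And>i. 1 \<le> i \<Longrightarrow> prob {\<omega> \<in> space M. Y i \<omega> = 1} = p"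
    and down: "\<And>i. 1 \<le> i \<Longrightarrow> prob {\<omega> \<in> space M. Y i \<omega> = -1} = 1 - p"
  shows "prob {\<omega> \<in> space M. (\<forall>i\<le>k. Y i \<omega> = s i) \<and>
            (\<forall>m\<in>{k..<k+j}. \<bar>\<Sum>i\<le>m. Y i \<omega>\<bar> < int (c m))}
       = (\<Prod>i\<le>k. prob {\<omega> \<in> space M. Y i \<omega> = s i}) * surv p (map c [k..<k+j]) (\<Sum>i\<le>k. s i)"
proof (induction j arbitrary: k s)
  case 0
  have "prob (\<Inter>i\<in>{..k}. Y i -` {s i} \<inter> space M) = (\<Prod>i\<in>{..k}. prob (Y i -` {s i} \<inter> space M))"
    by (rule indep_varsD[OF indep]) auto
  moreover have "(\<Inter>i\<in>{..k}. Y i -` {s i} \<inter> space M) = {\<omega> \<in> space M. \<forall>i\<le>k. Y i \<omega> = s i}"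
    by auto
  moreover have "Y i -` {s i} \<inter> space M = {\<omega> \<in> space M. Y i \<omega> = s i}" for i
    by auto
  ultimately show ?case by simp
next
  case (Suc j)
  have [measurable]: "Y i \<in> measurable M (count_space UNIV)" for i
    using indep by (auto simp: indep_vars_def)
  note [measurable] = pred_abs_partial_sum_less[of Y, OF this]
  let ?x = "\<Sum>i\<le>k. s i"
  let ?E = "\<lambda>k s j. {\<omega> \<in> space M. (\<forall>i\<le>k. Y i \<omega> = s i) \<and>
            (\<forall>m\<in>{k..<k+j}. \<bar>\<Sum>i\<le>m. Y i \<omega>\<bar> < int (c m))}"
  have sum_eq: "(\<Sum>i\<le>k. Y i \<omega>) = ?x" if "\<forall>i\<le>k. Y i \<omega> = s i" for \<omega>
    using that by (intro sum.cong) auto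
  have list_eq: "[k..<k + Suc j] = k # [Suc k..<Suc k + j]"
    by (simp add: upt_rec)
  show ?case
  proof (cases "\<bar>?x\<bar> < int (c k)")
    case False
    then have "?E k s (Suc j) = {}" using sum_eq by (auto intro!: bexI[of _ k])
    then show ?thesis unfolding list_eq using False by (simp only: measure_empty) simp
  next
    case True
    let ?s = "\<lambda>e. s(Suc k := e)"
    have split: "{k..<k + Suc j} = insert k {Suc k..<Suc k + j}" by auto
    have prefix: "(\<forall>i\<le>Suc k. Y i \<omega> = ?s e i) \<longleftrightarrow> (\<forall>i\<le>k. Y i \<omega> = s i) \<and> Y (Suc k) \<omega> = e"
      for \<omega> e by (auto simp: le_Suc_eq)
    have E_eq: "?E (Suc k) (?s e) j = {\<omega> \<in> ?E k s (Suc j). Y (Suc k) \<omega> = e}" for e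
      unfolding prefix split using True sum_eq by auto
    have meas [measurable]: "?E k' s' j' \<in> events" for k' s' j' by measurable
    have "prob {\<omega> \<in> space M. Y (Suc k) \<omega> = 1 \<or> Y (Suc k) \<omega> = -1}
        = prob ({\<omega> \<in> space M. Y (Suc k) \<omega> = 1} \<union> {\<omega> \<in> space M. Y (Suc k) \<omega> = -1})"
      by (rule arg_cong[where f = prob]) auto
    also have "\<dots> = p + (1 - p)"
      using up[of "Suc k"] down[of "Suc k"] by (subst finite_measure_Union) auto
    finally have ae: "AE \<omega> in M. Y (Suc k) \<omega> = 1 \<or> Y (Suc k) \<omega> = -1"
      by (subst prob_Collect_eq_1[symmetric]) auto
    have "prob (?E k s (Suc j)) = prob (?E (Suc k) (?s 1) j \<union> ?E (Suc k) (?s (-1)) j)"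
    proof (rule finite_measure_eq_AE)
      show "AE \<omega> in M. (\<omega> \<in> ?E k s (Suc j))
          = (\<omega> \<in> ?E (Suc k) (?s 1) j \<union> ?E (Suc k) (?s (-1)) j)"
        using ae unfolding E_eq by eventually_elim auto
    qed (use meas in auto)
    also have "\<dots> = prob (?E (Suc k) (?s 1) j) + prob (?E (Suc k) (?s (-1)) j)"
    proof (rule finite_measure_Union[OF meas meas])
      show "?E (Suc k) (?s 1) j \<inter> ?E (Suc k) (?s (-1)) j = {}" unfolding E_eq by auto
    qed
    finally have total: "prob (?E k s (Suc j))
      = prob (?E (Suc k) (?s 1) j) + prob (?E (Suc k) (?s (-1)) j)" .
    have sum_upd: "(\<Sum>i\<le>Suc k. ?s e i) = ?x + e" for e
      by simp
    have prod_upd: "(\<Prod>i\<le>Suc k. prob {\<omega> \<in> space M. Y i \<omega> = ?s e i})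
        = (\<Prod>i\<le>k. prob {\<omega> \<in> space M. Y i \<omega> = s i}) * prob {\<omega> \<in> space M. Y (Suc k) \<omega> = e}" for e
      by simp
    have probs: "prob {\<omega> \<in> space M. Y (Suc k) \<omega> = 1} = p"
        "prob {\<omega> \<in> space M. Y (Suc k) \<omega> = -1} = 1 - p"
      using up down by simp_all
    show ?thesis
      unfolding total Suc.IH sum_upd prod_upd list_eq probs
      using True by (simp add: algebra_simps del: upt_Suc)
  qed
qed

end

text \<open>
  The exit time ignores time \<open>0\<close>. The value \<open>2\<close> put in place of \<open>b 0\<close> is a barrier that the start
  \<open>\<plusminus>1\<close> always respects, so that the list of barriers can begin with the starting position.
\<close>

lemma prob_less_exit_time:
  fixes M :: "'a measure" and X0 :: "'a \<Rightarrow> int" and X :: "nat \<Rightarrow> 'a \<Rightarrow> int" and p :: real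
    and b :: "nat \<Rightarrow> nat" and n :: nat
  assumes M: "prob_space M"
    and start: "measure M {\<omega> \<in> space M. X0 \<omega> = 1} = 1/2"
      "measure M {\<omega> \<in> space M. X0 \<omega> = -1} = 1/2"
    and up: "\<And>n. 1 \<le> n \<Longrightarrow> measure M {\<omega> \<in> space M. X n \<omega> = 1} = p"
    and down: "\<And>n. 1 \<le> n \<Longrightarrow> measure M {\<omega> \<in> space M. X n \<omega> = -1} = 1 - p"
    and indep: "prob_space.indep_vars M (\<lambda>_. count_space UNIV) (\<lambda>n. if n = 0 then X0 else X n) UNIV"
  defines "bs \<equiv> map (b(0 := 2)) [0..<Suc n]"
  shows "measure M {\<omega> \<in> space M. enat n < exit_time b (walk X0 X) \<omega>}
       = (surv p bs 1 + surv p bs (- 1)) / 2"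
proof -
  interpret prob_space M by (rule M)
  define Y where "Y = (\<lambda>n. if n = 0 then X0 else X n)"
  have indepY: "indep_vars (\<lambda>_. count_space UNIV) Y UNIV"
    using indep unfolding Y_def .
  have [measurable]: "Y i \<in> measurable M (count_space UNIV)" for i
    using indepY by (auto simp: indep_vars_def)
  note [measurable] = pred_abs_partial_sum_less[of Y, OF this]
  have [measurable]: "X0 \<in> measurable M (count_space UNIV)"
    using \<open>Y 0 \<in> _\<close> by (simp add: Y_def)
  have walk: "walk X0 X m \<omega> = (\<Sum>i\<le>m. Y i \<omega>)" for m \<omega>
    unfolding walk_eq_sum_atMost Y_def ..
  let ?S = "{\<omega> \<in> space M. enat n < exit_time b (walk X0 X) \<omega>}"
  let ?E = "\<lambda>e. {\<omega> \<in> space M. (\<forall>i\<le>0. Y i \<omega> = e) \<and>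
        (\<forall>m\<in>{0..<0 + Suc n}. \<bar>\<Sum>i\<le>m. Y i \<omega>\<bar> < int ((b(0 := 2)) m))}"
  have S_meas: "?S \<in> events"
    unfolding less_exit_time_iff walk by measurable
  have "prob {\<omega> \<in> space M. X0 \<omega> = 1 \<or> X0 \<omega> = -1}
      = prob ({\<omega> \<in> space M. X0 \<omega> = 1} \<union> {\<omega> \<in> space M. X0 \<omega> = -1})"
    by (rule arg_cong[where f = prob]) auto
  also have "\<dots> = 1"
    using start by (subst finite_measure_Union) auto
  finally have ae: "AE \<omega> in M. X0 \<omega> = 1 \<or> X0 \<omega> = -1"
    by (subst prob_Collect_eq_1[symmetric]) auto
  have E_eq: "?E e = {\<omega> \<in> ?S. X0 \<omega> = e}" if "e = 1 \<or> e = -1" for e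
  proof -
    have split: "{0..<0 + Suc n} = insert 0 {1..n}" by auto
    have "Y 0 = X0" by (simp add: Y_def)
    then show ?thesis
      unfolding less_exit_time_iff walk split using that by (auto split: if_splits)
  qed
  have E_prob: "prob (?E e) = prob {\<omega> \<in> space M. X0 \<omega> = e} * surv p bs e" for e
    using prob_prefix_and_inside[OF indepY, of p 0 "\<lambda>_. e" "Suc n" "b(0 := 2)"] up down
    by (simp add: Y_def bs_def del: upt_Suc)
  have "prob ?S = prob (?E 1 \<union> ?E (-1))"
  proof (rule finite_measure_eq_AE)
    show "AE \<omega> in M. (\<omega> \<in> ?S) = (\<omega> \<in> ?E 1 \<union> ?E (-1))"
      using ae unfolding E_eq[OF disjI1[OF refl]] E_eq[OF disjI2[OF refl]]
      by eventually_elim auto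
  qed (use S_meas in measurable)
  also have "\<dots> = prob (?E 1) + prob (?E (-1))"
  proof (rule finite_measure_Union)
    show "?E 1 \<inter> ?E (-1) = {}" by auto
  qed measurable
  finally show ?thesis
    unfolding E_prob start by simp
qed

theorem theorem5:
  fixes M :: "'a measure"
    and X0 :: "'a \<Rightarrow> int"
    and X :: "real \<Rightarrow> nat \<Rightarrow> 'a \<Rightarrow> int"
    and b :: "nat \<Rightarrow> nat"
  assumes "prob_space M"
    and "measure M {\<omega> \<in> space M. X0 \<omega> = 1} = 1/2"
    and "measure M {\<omega> \<in> space M. X0 \<omega> = -1} = 1/2"
    and "\<And>p n. p \<in> {0..1} \<Longrightarrow> n \<ge> 1 \<Longrightarrow> measure M {\<omega> \<in> space M. X p n \<omega> = 1} = p"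
    and "\<And>p n. p \<in> {0..1} \<Longrightarrow> n \<ge> 1 \<Longrightarrow> measure M {\<omega> \<in> space M. X p n \<omega> = -1} = 1 - p"
    and "\<And>p. p \<in> {0..1} \<Longrightarrow>
      prob_space.indep_vars M (\<lambda>_. count_space UNIV) (\<lambda>n. if n = 0 then X0 else X p n) UNIV"
  shows "stochastically_increasing_on {0..1/2} M (\<lambda>p. exit_time b (walk X0 (X p)))
    \<and> stochastically_decreasing_on {1/2..1} M (\<lambda>p. exit_time b (walk X0 (X p)))"
proof -
  have law: "measure M {\<omega> \<in> space M. enat n < exit_time b (walk X0 (X p)) \<omega>}
      = (surv p (map (b(0 := 2)) [0..<Suc n]) 1 + surv p (map (b(0 := 2)) [0..<Suc n]) (- 1)) / 2"
    if "p \<in> {0..1}" for p n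
    using that assms by (intro prob_less_exit_time) auto
  show ?thesis
    unfolding stochastically_increasing_on_def stochastically_decreasing_on_def
  proof (intro conjI allI impI monotone_onI)
    fix n :: nat and p q :: real
    assume "p \<in> {0..1/2}" "q \<in> {0..1/2}" "p \<le> q"
    then show "measure M {\<omega> \<in> space M. enat n < exit_time b (walk X0 (X p)) \<omega>}
        \<le> measure M {\<omega> \<in> space M. enat n < exit_time b (walk X0 (X q)) \<omega>}"
      using symmetric_surv_mono[of p q "map (b(0 := 2)) [0..<Suc n]"]
      by (simp add: law del: upt_Suc)
  next
    fix n :: nat and p q :: real
    assume "p \<in> {1/2..1}" "q \<in> {1/2..1}" "p \<le> q"
    then show "measure M {\<omega> \<in> space M. enat n < exit_time b (walk X0 (X q)) \<omega>}
        \<le> measure M {\<omega> \<in> space M. enat n < exit_time b (walk X0 (X p)) \<omega>}"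
      using symmetric_surv_antimono[of p q "map (b(0 := 2)) [0..<Suc n]"]
      by (simp add: law del: upt_Suc)
  qed
qed

end
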